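(* Let $d:\mathcal{A}\to A$ be a $\rho_\theta$-invariant derivation. Then there exists a function $\beta\in c_{inc}(\mathbb{Z})$, unique modulo an additive constant, such that $d(a)=[\beta(\mathbb{K}),a]$ for all $a\in\mathcal{A}$. If moreover $d:\mathcal{A}\to\mathcal{A}$ (i.e. $d(\mathcal{A})\subset\mathcal{A}$), then the corresponding function $\beta$ is eventually linear.
   Context: Let $\{E_k\}_{k\in\mathbb{Z}}$ be the canonical basis of $\ell^2(\mathbb{Z})$, $UE_k=E_{k+1}$ the bilateral shift, and for $a:\mathbb{Z}\to\mathbb{C}$ let $a(\mathbb{K})$ be the (possibly unbounded) diagonal operator $a(\mathbb{K})E_k=a(k)E_k$; $\mathbb{K}E_k=kE_k$. Fix $0<r<1$ and let $U_rE_k=rE_{k+1}$ for $k<0$, $U_rE_k=E_{k+1}$ for $k\ge0$. The quantum annulus is the unital C$^*$-algebra $A=C^*(U_r)$ of operators on $\ell^2(\mathbb{Z})$. $c(\mathbb{Z})$ is the set of $a:\mathbb{Z}\to\mathbb{C}$ for which both limits $\lim_{k\to\infty}a(k)$ and $\lim_{k\to-\infty}a(k)$ exist (possibly different). $c_{00}^\pm(\mathbb{Z})$ is the set of eventually constant functions: there is $k_0$ such that $a$ is constant on $\{k\ge k_0\}$ and constant on $\{k\le-k_0\}$ (possibly different constants). $c_{inc}(\mathbb{Z})$ is the set of $\beta:\mathbb{Z}\to\mathbb{C}$ with $\{\beta(k)-\beta(k-1)\}_k\in c(\mathbb{Z})$; $\beta$ is eventually linear if $\{\beta(k)-\beta(k-1)\}_k\in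 c_{00}^\pm(\mathbb{Z})$. $\mathcal{A}$ is the dense $*$-subalgebra of $A$ of finite sums $\sum_nU^na_n(\mathbb{K})$ with $a_n\in c_{00}^\pm(\mathbb{Z})$. A derivation $d:\mathcal{A}\to A$ is a linear map with $d(ab)=ad(b)+d(a)b$. For $\theta\in[0,2\pi)$, $\rho_\theta$ is the automorphism of $A$ given by $\rho_\theta(a)=e^{i\theta\mathbb{K}}ae^{-i\theta\mathbb{K}}$ (so $\rho_\theta(U)=e^{i\theta}U$ and $\rho_\theta(a(\mathbb{K}))=a(\mathbb{K})$). A derivation $d:\mathcal{A}\to A$ is $\rho_\theta$-invariant if $\rho_\theta(d(a))=d(\rho_\theta(a))$ for all $a\in\mathcal{A}$ and all $\theta$. The commutator $[\beta(\mathbb{K}),a]$ is understood as an operator on finite linear combinations of the $E_k$, extended by continuity. *)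

theory Defs
  imports "HOL-Analysis.Analysis"
begin

lemma square_sum_add:
  fixes f g :: "int \<Rightarrow> complex"
  assumes "(\<lambda>k. (cmod (f k))\<^sup>2) summable_on UNIV" "(\<lambda>k. (cmod (g k))\<^sup>2) summable_on UNIV"
  shows "(\<lambda>k. (cmod (f k + g k))\<^sup>2) summable_on UNIV"
proof (rule summable_on_comparison_test)
  show "(\<lambda>k. 2 * (cmod (f k))\<^sup>2 + 2 * (cmod (g k))\<^sup>2) summable_on UNIV"
    using assms by (intro summable_on_add summable_on_cmult_right)
  fix k
  have "(cmod (f k + g k))\<^sup>2 \<le> (cmod (f k) + cmod (g k))\<^sup>2"
    by (intro power_mono norm_triangle_ineq) auto
  also have "\<dots> \<le> 2 * (cmod (f k))\<^sup>2 + 2 * (cmod (g k))\<^sup>2"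
    using sum_squares_bound[of "cmod (f k)" "cmod (g k)"] by (simp add: power2_sum)
  finally show "(cmod (f k + g k))\<^sup>2 \<le> 2 * (cmod (f k))\<^sup>2 + 2 * (cmod (g k))\<^sup>2" .
qed auto

lemma square_sum_bounded_mult:
  fixes f g :: "int \<Rightarrow> complex"
  assumes "(\<lambda>k. (cmod (f k))\<^sup>2) summable_on UNIV" "\<And>k. cmod (g k) \<le> M"
  shows "(\<lambda>k. (cmod (g k * f k))\<^sup>2) summable_on UNIV"
proof (rule summable_on_comparison_test)
  show "(\<lambda>k. M\<^sup>2 * (cmod (f k))\<^sup>2) summable_on UNIV"
    using assms by (intro summable_on_cmult_right)
  fix k show "(cmod (g k * f k))\<^sup>2 \<le> M\<^sup>2 * (cmod (f k))\<^sup>2"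
    using assms(2)[of k] by (auto simp: norm_mult power_mult_distrib intro!: mult_right_mono power_mono)
qed auto

lemma square_sum_mult:
  fixes f g :: "int \<Rightarrow> complex"
  assumes "(\<lambda>k. (cmod (f k))\<^sup>2) summable_on UNIV" "(\<lambda>k. (cmod (g k))\<^sup>2) summable_on UNIV"
  shows "(\<lambda>k. cnj (f k) * g k) summable_on UNIV"
proof (rule abs_summable_summable, rule summable_on_comparison_test)
  show "(\<lambda>k. (cmod (f k))\<^sup>2 + (cmod (g k))\<^sup>2) summable_on UNIV"
    using assms by (intro summable_on_add)
  fix k
  have "2 * (cmod (f k) * cmod (g k)) \<le> (cmod (f k))\<^sup>2 + (cmod (g k))\<^sup>2"
    using sum_squares_bound[of "cmod (f k)" "cmod (g k)"] by simp
  moreover have "0 \<le> cmod (f k) * cmod (g k)" by simp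
  ultimately show "norm (cnj (f k) * g k) \<le> (cmod (f k))\<^sup>2 + (cmod (g k))\<^sup>2"
    unfolding norm_mult complex_mod_cnj by linarith
qed auto

typedef ell2 = "{x :: int \<Rightarrow> complex. (\<lambda>k. (cmod (x k))\<^sup>2) summable_on UNIV}"
  morphisms coord Abs_ell2
  by (rule exI[of _ "\<lambda>_. 0"]) simp

setup_lifting type_definition_ell2

lemma ell2_eqI: "(\<And>k. coord x k = coord y k) \<Longrightarrow> x = y"
  by (metis coord_inject ext)

lemma coord_square_summable: "(\<lambda>k. (cmod (coord x k))\<^sup>2) summable_on UNIV"
  using coord[of x] by simp

lift_definition cscale :: "complex \<Rightarrow> ell2 \<Rightarrow> ell2" is "\<lambda>c x k. c * x k"
  by (rule square_sum_bounded_mult[OF _ order_refl])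

lift_definition cinner :: "ell2 \<Rightarrow> ell2 \<Rightarrow> complex" is
  "\<lambda>x y. \<Sum>\<^sub>\<infinity>k. cnj (x k) * y k" .

lemma cinner_summable: "(\<lambda>k. cnj (coord x k) * coord y k) summable_on UNIV"
  by (intro square_sum_mult coord_square_summable)

instantiation ell2 :: real_inner
begin

lift_definition zero_ell2 :: ell2 is "\<lambda>_. 0" by simp
lift_definition plus_ell2 :: "ell2 \<Rightarrow> ell2 \<Rightarrow> ell2" is "\<lambda>x y k. x k + y k"
  by (rule square_sum_add)
lift_definition uminus_ell2 :: "ell2 \<Rightarrow> ell2" is "\<lambda>x k. - x k" by simp
definition minus_ell2 :: "ell2 \<Rightarrow> ell2 \<Rightarrow> ell2" where "minus_ell2 x y = x + (- y)"
definition scaleR_ell2 :: "real \<Rightarrow> ell2 \<Rightarrow> ell2" where "scaleR_ell2 t x = cscale (of_real t) x"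
definition inner_ell2 :: "ell2 \<Rightarrow> ell2 \<Rightarrow> real" where "inner_ell2 x y = Re (cinner x y)"
definition norm_ell2 :: "ell2 \<Rightarrow> real" where "norm_ell2 x = sqrt (inner x x)"
definition dist_ell2 :: "ell2 \<Rightarrow> ell2 \<Rightarrow> real" where "dist_ell2 x y = norm (x - y)"
definition sgn_ell2 :: "ell2 \<Rightarrow> ell2" where "sgn_ell2 x = inverse (norm x) *\<^sub>R x"
definition uniformity_ell2 :: "(ell2 \<times> ell2) filter" where
  "uniformity_ell2 = (INF e\<in>{0<..}. principal {(x, y). dist x y < e})"
definition open_ell2 :: "ell2 set \<Rightarrow> bool" where
  "open_ell2 S = (\<forall>x\<in>S. \<forall>\<^sub>F (x', y) in uniformity. x' = x \<longrightarrow> y \<in> S)"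

instance
proof
  fix x y z :: ell2 and s t :: real
  have inner_sum: "inner u v = (\<Sum>\<^sub>\<infinity>k. Re (cnj (coord u k) * coord v k))" for u v :: ell2
    using infsum_Re[OF cinner_summable] by (simp add: inner_ell2_def cinner.rep_eq)
  have summable_Re: "(\<lambda>k. Re (cnj (coord u k) * coord v k)) summable_on UNIV" for u v :: ell2
    by (intro summable_on_Re cinner_summable)
  show "x + y + z = x + (y + z)" "x + y = y + x" "0 + x = x" "- x + x = 0"
    by (transfer; simp add: algebra_simps)+
  show "x - y = x + - y" by (rule minus_ell2_def)
  show "s *\<^sub>R (x + y) = s *\<^sub>R x + s *\<^sub>R y" "(s + t) *\<^sub>R x = s *\<^sub>R x + t *\<^sub>R x"
    "s *\<^sub>R t *\<^sub>R x = (s * t) *\<^sub>R x" "1 *\<^sub>R x = x"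
    unfolding scaleR_ell2_def by (transfer; simp add: algebra_simps)+
  show "dist x y = norm (x - y)" by (rule dist_ell2_def)
  show "sgn x = inverse (norm x) *\<^sub>R x" by (rule sgn_ell2_def)
  show "uniformity = (INF e\<in>{0<..}. principal {(x :: ell2, y). dist x y < e})"
    by (rule uniformity_ell2_def)
  show "open S = (\<forall>x\<in>S. \<forall>\<^sub>F (x', y) in uniformity. x' = x \<longrightarrow> y \<in> S)" for S :: "ell2 set"
    by (rule open_ell2_def)
  show "norm x = sqrt (inner x x)" by (rule norm_ell2_def)
  show "inner x y = inner y x"
    unfolding inner_sum by (simp add: mult.commute)
  show "inner (x + y) z = inner x z + inner y z"
    unfolding inner_sum infsum_add[OF summable_Re summable_Re, symmetric]
    by (simp add: plus_ell2.rep_eq algebra_simps)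
  show "inner (s *\<^sub>R x) y = s * inner x y"
    unfolding inner_sum infsum_cmult_right'[symmetric]
    by (simp add: scaleR_ell2_def cscale.rep_eq algebra_simps)
  have nonneg: "0 \<le> Re (cnj (coord x k) * coord x k)" for k by simp
  show "0 \<le> inner x x"
    unfolding inner_sum by (rule infsum_nonneg) simp
  show "inner x x = 0 \<longleftrightarrow> x = 0"
  proof
    assume "inner x x = 0"
    hence "Re (cnj (coord x k) * coord x k) = 0" for k
      unfolding inner_sum by (intro nonneg_infsum_le_0D[OF _ summable_Re]) auto
    hence "coord x k = 0" for k
      by (simp add: complex_eq_iff sum_power2_eq_zero_iff flip: power2_eq_square)
    thus "x = 0" by (intro ell2_eqI) (simp add: zero_ell2.rep_eq)
  qed (simp add: inner_sum zero_ell2.rep_eq)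
qed

end

lemma coord_zero [simp]: "coord 0 k = 0"
  by (simp add: zero_ell2.rep_eq)

lemma coord_add [simp]: "coord (x + y) k = coord x k + coord y k"
  by (simp add: plus_ell2.rep_eq)

lemma coord_uminus [simp]: "coord (- x) k = - coord x k"
  by (simp add: uminus_ell2.rep_eq)

lemma coord_diff [simp]: "coord (x - y) k = coord x k - coord y k"
  unfolding minus_ell2_def coord_add coord_uminus by (rule add_uminus_conv_diff)

lemma coord_cscale [simp]: "coord (cscale c x) k = c * coord x k"
  by (simp add: cscale.rep_eq)

lemma coord_scaleR [simp]: "coord (t *\<^sub>R x) k = of_real t * coord x k"
  by (simp add: scaleR_ell2_def)

lemma coord_sum: "coord (sum f N) k = (\<Sum>n\<in>N. coord (f n) k)"
  by (induction N rule: infinite_finite_induct) auto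

lemma norm_ell2_square: "(norm (x :: ell2))\<^sup>2 = (\<Sum>\<^sub>\<infinity>k. (cmod (coord x k))\<^sup>2)"
proof -
  have "(norm x)\<^sup>2 = Re (cinner x x)"
    unfolding power2_norm_eq_inner inner_ell2_def ..
  also have "\<dots> = (\<Sum>\<^sub>\<infinity>k. Re (cnj (coord x k) * coord x k))"
    unfolding cinner.rep_eq by (rule infsum_Re[OF cinner_summable, symmetric])
  also have "\<dots> = (\<Sum>\<^sub>\<infinity>k. (cmod (coord x k))\<^sup>2)"
    unfolding cmod_power2 by (simp add: power2_eq_square)
  finally show ?thesis .
qed

lift_definition basis_vec :: "int \<Rightarrow> ell2" is "\<lambda>k j. if j = k then 1 else 0"
proof -
  fix k :: int
  have "(\<lambda>j. (cmod (if j = k then 1 else 0))\<^sup>2) summable_on {k}" by simp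
  thus "(\<lambda>j. (cmod (if j = k then 1 else 0))\<^sup>2) summable_on UNIV"
    by (rule summable_on_cong_neutral[THEN iffD1, rotated 3]) auto
qed

definition finite_combinations :: "ell2 set" where
  "finite_combinations = {\<Sum>k\<in>N. cscale (c k) (basis_vec k) | N c. finite N}"

lemma finite_combinations_iff: "x \<in> finite_combinations \<longleftrightarrow> finite {k. coord x k \<noteq> 0}"
proof
  assume "x \<in> finite_combinations"
  then obtain N c where N: "finite N" and x: "x = (\<Sum>k\<in>N. cscale (c k) (basis_vec k))"
    by (auto simp: finite_combinations_def)
  have "coord x k = 0" if "k \<notin> N" for k
    using that by (auto simp: x coord_sum basis_vec.rep_eq intro!: sum.neutral)
  thus "finite {k. coord x k \<noteq> 0}"
    by (intro finite_subset[OF _ N]) auto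
next
  assume fin: "finite {k. coord x k \<noteq> 0}"
  have "x = (\<Sum>k\<in>{k. coord x k \<noteq> 0}. cscale (coord x k) (basis_vec k))"
    by (intro ell2_eqI)
      (simp add: coord_sum basis_vec.rep_eq if_distrib[of "\<lambda>t. _ * t"] fin cong: if_cong)
  thus "x \<in> finite_combinations"
    unfolding finite_combinations_def using fin by blast
qed

lemma bounded_linear_by_coord:
  fixes T :: "ell2 \<Rightarrow> ell2"
  assumes "\<And>x y. T (x + y) = T x + T y" "\<And>c x. T (cscale c x) = cscale c (T x)"
    and "\<And>x. (norm (T x))\<^sup>2 \<le> (norm x * M)\<^sup>2" "0 \<le> M"
  shows "bounded_linear T"
proof (rule bounded_linear_intro[where K = M])
  show "T (x + y) = T x + T y" for x y
    by (rule assms(1))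
  show "T (t *\<^sub>R x) = t *\<^sub>R T x" for t x
    unfolding scaleR_ell2_def by (rule assms(2))
  show "norm (T x) \<le> norm x * M" for x
    by (rule power2_le_imp_le[OF assms(3)]) (intro mult_nonneg_nonneg norm_ge_zero assms(4))
qed

text \<open>The bounded operators on the complex Hilbert space. The type \<^typ>\<open>ell2 \<Rightarrow>\<^sub>L ell2\<close>
  only demands real linearity, so complex linearity has to be imposed.\<close>

definition bounded_operators :: "(ell2 \<Rightarrow>\<^sub>L ell2) set" where
  "bounded_operators = {T. \<forall>c x. blinfun_apply T (cscale c x) = cscale c (blinfun_apply T x)}"

definition opscale :: "complex \<Rightarrow> (ell2 \<Rightarrow>\<^sub>L ell2) \<Rightarrow> (ell2 \<Rightarrow>\<^sub>L ell2)" where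
  "opscale c T = Blinfun (cscale c) o\<^sub>L T"

lemma bounded_linear_cscale: "bounded_linear (cscale c)"
proof (rule bounded_linear_by_coord[where M = "cmod c"])
  show "(norm (cscale c x))\<^sup>2 \<le> (norm x * cmod c)\<^sup>2" for x
    unfolding power_mult_distrib norm_ell2_square coord_cscale norm_mult infsum_cmult_right'
    by (simp only: mult.commute order_refl)
qed (auto intro!: ell2_eqI simp: algebra_simps)

lemma opscale_apply: "blinfun_apply (opscale c T) x = cscale c (blinfun_apply T x)"
  by (simp add: opscale_def bounded_linear_Blinfun_apply[OF bounded_linear_cscale])

definition is_adjoint :: "(ell2 \<Rightarrow>\<^sub>L ell2) \<Rightarrow> (ell2 \<Rightarrow>\<^sub>L ell2) \<Rightarrow> bool" where
  "is_adjoint T S \<longleftrightarrow> (\<forall>x y. cinner (blinfun_apply T x) y = cinner x (blinfun_apply S y))"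

definition unital_cstar_subalgebra :: "(ell2 \<Rightarrow>\<^sub>L ell2) set \<Rightarrow> bool" where
  "unital_cstar_subalgebra B \<longleftrightarrow>
     B \<subseteq> bounded_operators \<and> closed B \<and> id_blinfun \<in> B \<and>
     (\<forall>S\<in>B. \<forall>T\<in>B. S + T \<in> B) \<and>
     (\<forall>c. \<forall>T\<in>B. opscale c T \<in> B) \<and>
     (\<forall>S\<in>B. \<forall>T\<in>B. S o\<^sub>L T \<in> B) \<and>
     (\<forall>T\<in>B. \<forall>S. is_adjoint T S \<longrightarrow> S \<in> B)"

definition cstar_generated :: "(ell2 \<Rightarrow>\<^sub>L ell2) \<Rightarrow> (ell2 \<Rightarrow>\<^sub>L ell2) set" where
  "cstar_generated T = \<Inter>{B. unital_cstar_subalgebra B \<and> T \<in> B}"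

lift_definition shift_fun :: "int \<Rightarrow> ell2 \<Rightarrow> ell2" is "\<lambda>n x k. x (k - n)"
proof -
  fix n :: int and x :: "int \<Rightarrow> complex"
  have "bij_betw (\<lambda>k. k - n) UNIV UNIV"
    by (rule bij_betwI[where g = "\<lambda>k. k + n"]) auto
  thus "(\<lambda>k. (cmod (x k))\<^sup>2) summable_on UNIV \<Longrightarrow> (\<lambda>k. (cmod (x (k - n)))\<^sup>2) summable_on UNIV"
    using summable_on_reindex_bij_betw[of "\<lambda>k. k - n" UNIV UNIV "\<lambda>k. (cmod (x k))\<^sup>2"] by simp
qed

text \<open>The integer power \<open>U\<^sup>n\<close> of the bilateral shift: \<open>U\<^sup>n E\<^sub>k = E\<^bsub>k+n\<^esub>\<close>.\<close>

definition Upow :: "int \<Rightarrow> ell2 \<Rightarrow>\<^sub>L ell2" where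
  "Upow n = Blinfun (shift_fun n)"

lemma coord_Upow [simp]: "coord (blinfun_apply (Upow n) x) k = coord x (k - n)"
proof -
  have "bounded_linear (shift_fun n)"
  proof (rule bounded_linear_by_coord[where M = 1])
    have "bij_betw (\<lambda>k. k - n) UNIV UNIV"
      by (rule bij_betwI[where g = "\<lambda>k. k + n"]) auto
    thus "(norm (shift_fun n x))\<^sup>2 \<le> (norm x * 1)\<^sup>2" for x
      using infsum_reindex_bij_betw[of "\<lambda>k. k - n" UNIV UNIV "\<lambda>k. (cmod (coord x k))\<^sup>2"]
      by (simp add: norm_ell2_square shift_fun.rep_eq)
  qed (auto intro!: ell2_eqI simp: shift_fun.rep_eq)
  thus ?thesis
    by (simp add: Upow_def bounded_linear_Blinfun_apply shift_fun.rep_eq)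
qed

lemma Upow_basis_vec: "blinfun_apply (Upow n) (basis_vec k) = basis_vec (k + n)"
  by (rule ell2_eqI) (auto simp: basis_vec.rep_eq)

lemma Upow_0: "Upow 0 = id_blinfun"
  by (auto intro!: blinfun_eqI ell2_eqI)

lemma Upow_add: "Upow (m + n) = Upow m o\<^sub>L Upow n"
  by (auto intro!: blinfun_eqI ell2_eqI simp: algebra_simps)

text \<open>The possibly unbounded diagonal operator \<open>a(\<K>)\<close>, on its maximal domain; the value
  outside this domain is an irrelevant default.\<close>

lift_definition diag_fun :: "(int \<Rightarrow> complex) \<Rightarrow> ell2 \<Rightarrow> ell2" is
  "\<lambda>a x. if (\<lambda>k. (cmod (a k * x k))\<^sup>2) summable_on UNIV then (\<lambda>k. a k * x k) else (\<lambda>_. 0)"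
  by auto

lemma coord_diag_fun_finite:
  assumes "x \<in> finite_combinations"
  shows "coord (diag_fun a x) k = a k * coord x k"
proof -
  have "(\<lambda>k. (cmod (a k * coord x k))\<^sup>2) summable_on {k. coord x k \<noteq> 0}"
    using assms by (simp add: finite_combinations_iff)
  hence "(\<lambda>k. (cmod (a k * coord x k))\<^sup>2) summable_on UNIV"
    by (rule summable_on_cong_neutral[THEN iffD1, rotated 3]) auto
  thus ?thesis by (simp add: diag_fun.rep_eq)
qed

text \<open>Only meaningful for bounded \<open>a\<close>, see \<open>coord_diag\<close>.\<close>

definition diag :: "(int \<Rightarrow> complex) \<Rightarrow> ell2 \<Rightarrow>\<^sub>L ell2" where
  "diag a = Blinfun (diag_fun a)"

lemma coord_diag:
  assumes "bounded (range a)"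
  shows "coord (blinfun_apply (diag a) x) k = a k * coord x k"
proof -
  obtain M where M: "\<And>k. cmod (a k) \<le> M"
    using assms unfolding bounded_iff by auto
  have "0 \<le> M" by (rule order_trans[OF norm_ge_zero M])
  have summ: "(\<lambda>k. (cmod (a k * coord x k))\<^sup>2) summable_on UNIV" for x
    by (rule square_sum_bounded_mult[OF coord_square_summable M])
  hence coord_fun: "coord (diag_fun a x) k = a k * coord x k" for x k
    by (simp add: diag_fun.rep_eq)
  have "bounded_linear (diag_fun a)"
  proof (rule bounded_linear_by_coord[where M = M])
    fix x
    have "(\<Sum>\<^sub>\<infinity>k. (cmod (a k * coord x k))\<^sup>2) \<le> (\<Sum>\<^sub>\<infinity>k. M\<^sup>2 * (cmod (coord x k))\<^sup>2)"
    proof (rule infsum_mono)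
      show "(cmod (a k * coord x k))\<^sup>2 \<le> M\<^sup>2 * (cmod (coord x k))\<^sup>2" for k
        using M[of k]
        by (auto simp: norm_mult power_mult_distrib intro!: mult_right_mono power_mono)
    qed (use summ coord_square_summable in \<open>auto intro: summable_on_cmult_right\<close>)
    thus "(norm (diag_fun a x))\<^sup>2 \<le> (norm x * M)\<^sup>2"
      unfolding power_mult_distrib norm_ell2_square coord_fun infsum_cmult_right'
      by (simp only: mult.commute)
  qed (auto intro!: ell2_eqI simp: coord_fun algebra_simps \<open>0 \<le> M\<close>)
  thus ?thesis
    by (simp add: diag_def bounded_linear_Blinfun_apply coord_fun)
qed

definition U_r :: "real \<Rightarrow> ell2 \<Rightarrow>\<^sub>L ell2" where
  "U_r r = Upow 1 o\<^sub>L diag (\<lambda>k. if k < 0 then of_real r else 1)"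

lemma U_r_basis_vec:
  "blinfun_apply (U_r r) (basis_vec k) =
     cscale (if k < 0 then of_real r else 1) (basis_vec (k + 1))"
proof -
  have "bounded (range (\<lambda>k::int. if k < 0 then complex_of_real r else 1))"
    by (rule bounded_subset[of "{of_real r, 1}"]) auto
  thus ?thesis
    by (intro ell2_eqI) (auto simp: U_r_def coord_diag basis_vec.rep_eq)
qed

definition quantum_annulus :: "real \<Rightarrow> (ell2 \<Rightarrow>\<^sub>L ell2) set" where
  "quantum_annulus r = cstar_generated (U_r r)"

definition c_Z :: "(int \<Rightarrow> complex) set" where
  "c_Z = {a. (\<exists>l. (a \<longlongrightarrow> l) at_top) \<and> (\<exists>l. (a \<longlongrightarrow> l) at_bot)}"

definition c00_pm :: "(int \<Rightarrow> complex) set" where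
  "c00_pm = {a. \<exists>k0. a constant_on {k0..} \<and> a constant_on {..-k0}}"

definition c_inc :: "(int \<Rightarrow> complex) set" where
  "c_inc = {\<beta>. (\<lambda>k. \<beta> k - \<beta> (k - 1)) \<in> c_Z}"

definition eventually_linear :: "(int \<Rightarrow> complex) \<Rightarrow> bool" where
  "eventually_linear \<beta> \<longleftrightarrow> (\<lambda>k. \<beta> k - \<beta> (k - 1)) \<in> c00_pm"

lemma bounded_c00_pm:
  assumes "a \<in> c00_pm"
  shows "bounded (range a)"
proof -
  obtain k0 c c' where "\<forall>k\<ge>k0. a k = c" "\<forall>k\<le>-k0. a k = c'"
    using assms unfolding c00_pm_def constant_on_def mem_Collect_eq Ball_def atLeast_iff atMost_iff
    by blast
  hence "a k \<in> insert c (insert c' (a ` {-k0..k0}))" for k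
    by (cases "k0 \<le> k"; cases "k \<le> - k0") auto
  hence "range a \<subseteq> insert c (insert c' (a ` {-k0..k0}))"
    by blast
  thus ?thesis
    by (rule bounded_subset[rotated]) (simp add: finite_imp_bounded)
qed

definition poly_algebra :: "(ell2 \<Rightarrow>\<^sub>L ell2) set" where
  "poly_algebra = {\<Sum>n\<in>N. Upow n o\<^sub>L diag (a n) | N a. finite N \<and> (\<forall>n\<in>N. a n \<in> c00_pm)}"

definition is_derivation ::
  "(ell2 \<Rightarrow>\<^sub>L ell2) set \<Rightarrow> (ell2 \<Rightarrow>\<^sub>L ell2) set \<Rightarrow> ((ell2 \<Rightarrow>\<^sub>L ell2) \<Rightarrow> (ell2 \<Rightarrow>\<^sub>L ell2)) \<Rightarrow> bool" where
  "is_derivation D B d \<longleftrightarrow>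
     (\<forall>S\<in>D. d S \<in> B) \<and>
     (\<forall>S\<in>D. \<forall>T\<in>D. d (S + T) = d S + d T) \<and>
     (\<forall>c. \<forall>S\<in>D. d (opscale c S) = opscale c (d S)) \<and>
     (\<forall>S\<in>D. \<forall>T\<in>D. d (S o\<^sub>L T) = (S o\<^sub>L d T) + (d S o\<^sub>L T))"

definition rho :: "real \<Rightarrow> (ell2 \<Rightarrow>\<^sub>L ell2) \<Rightarrow> (ell2 \<Rightarrow>\<^sub>L ell2)" where
  "rho \<theta> T = diag (\<lambda>k. exp (\<i> * of_real \<theta> * of_int k)) o\<^sub>L T o\<^sub>L diag (\<lambda>k. exp (- \<i> * of_real \<theta> * of_int k))"

lemma rho_Upow_diag:
  assumes "a \<in> c00_pm"
  shows "rho \<theta> (Upow n o\<^sub>L diag a) =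
    opscale (exp (\<i> * of_real \<theta> * of_int n)) (Upow n o\<^sub>L diag a)"
proof -
  have b1: "bounded (range (\<lambda>k::int. exp (\<i> * of_real \<theta> * of_int k)))"
    and b2: "bounded (range (\<lambda>k::int. exp (- \<i> * of_real \<theta> * of_int k)))"
    unfolding bounded_iff by (auto intro!: exI[of _ 1])
  show ?thesis
    unfolding rho_def
    by (intro blinfun_eqI ell2_eqI)
      (simp only: blinfun_apply_blinfun_compose opscale_apply coord_cscale coord_Upow
        coord_diag[OF b1] coord_diag[OF b2] coord_diag[OF bounded_c00_pm[OF assms]],
       simp add: right_diff_distrib exp_diff exp_minus field_simps)
qed

definition rho_invariant :: "((ell2 \<Rightarrow>\<^sub>L ell2) \<Rightarrow> (ell2 \<Rightarrow>\<^sub>L ell2)) \<Rightarrow> bool" where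
  "rho_invariant d \<longleftrightarrow> (\<forall>\<theta>\<in>{0..<2 * pi}. \<forall>T\<in>poly_algebra. rho \<theta> (d T) = d (rho \<theta> T))"

text \<open>The bounded operator \<open>S\<close> is the extension by continuity of the commutator \<open>[\<beta>(\<K>), T]\<close>
  of operators on finite linear combinations of the basis vectors. Such combinations lie in the
  domain of \<open>\<beta>(\<K>)\<close>, are mapped to such combinations by every \<open>T\<close> in the dense subalgebra
  (\<open>poly_algebra_finite_combinations\<close>), and determine \<open>S\<close> (\<open>blinfun_eq_on_finite_combinations\<close>).\<close>

definition extends_commutator ::
  "(ell2 \<Rightarrow>\<^sub>L ell2) \<Rightarrow> (int \<Rightarrow> complex) \<Rightarrow> (ell2 \<Rightarrow>\<^sub>L ell2) \<Rightarrow> bool" where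
  "extends_commutator S \<beta> T \<longleftrightarrow>
     (\<forall>x\<in>finite_combinations.
        blinfun_apply S x = diag_fun \<beta> (blinfun_apply T x) - blinfun_apply T (diag_fun \<beta> x))"

lemma poly_algebra_finite_combinations:
  assumes "T \<in> poly_algebra" "x \<in> finite_combinations"
  shows "blinfun_apply T x \<in> finite_combinations"
proof -
  obtain N a where N: "finite N" and a: "\<forall>n\<in>N. a n \<in> c00_pm"
    and T: "T = (\<Sum>n\<in>N. Upow n o\<^sub>L diag (a n))"
    using assms(1) by (auto simp: poly_algebra_def)
  have Tx: "coord (blinfun_apply T x) k = (\<Sum>n\<in>N. a n (k - n) * coord x (k - n))" for k
    using a by (simp add: T blinfun.sum_left coord_sum coord_diag bounded_c00_pm)
  have "{k. coord (blinfun_apply T x) k \<noteq> 0} \<subseteq>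
          (\<lambda>(n, j). n + j) ` (N \<times> {j. coord x j \<noteq> 0})"
  proof
    fix k assume "k \<in> {k. coord (blinfun_apply T x) k \<noteq> 0}"
    hence "\<exists>n\<in>N. coord x (k - n) \<noteq> 0"
      unfolding Tx by (metis (mono_tags, lifting) mem_Collect_eq mult_zero_right sum.neutral)
    then obtain n where "n \<in> N" "coord x (k - n) \<noteq> 0" by blast
    thus "k \<in> (\<lambda>(n, j). n + j) ` (N \<times> {j. coord x j \<noteq> 0})"
      by (intro image_eqI[of _ _ "(n, k - n)"]) auto
  qed
  thus ?thesis
    using N assms(2) unfolding finite_combinations_iff by (meson finite_SigmaI finite_imageI finite_subset)
qed

lemma closure_finite_combinations: "closure finite_combinations = UNIV"
proof -
  have "\<exists>y\<in>finite_combinations. dist y x < e" if "0 < e" for x e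
  proof -
    let ?f = "\<lambda>k. (cmod (coord x k))\<^sup>2"
    have "0 < e\<^sup>2 / 2" using that by simp
    then obtain F where F: "finite F" and close: "dist (sum ?f F) (infsum ?f UNIV) \<le> e\<^sup>2 / 2"
      using infsum_finite_approximation[OF coord_square_summable] by blast
    define y where "y = (\<Sum>k\<in>F. cscale (coord x k) (basis_vec k))"
    have y: "coord y k = (if k \<in> F then coord x k else 0)" for k
      by (simp add: y_def coord_sum basis_vec.rep_eq if_distrib[of "\<lambda>t. _ * t"] F cong: if_cong)
    have "(norm (y - x))\<^sup>2 = infsum ?f (UNIV - F)"
      unfolding norm_ell2_square by (rule infsum_cong_neutral) (auto simp: y)
    also have "\<dots> = infsum ?f UNIV - sum ?f F"
      using F by (subst infsum_Diff) (auto simp: coord_square_summable)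
    also have "\<dots> \<le> e\<^sup>2 / 2"
      using close unfolding dist_real_def by linarith
    also have "\<dots> < e\<^sup>2" using that by simp
    finally have "dist y x < e"
      unfolding dist_norm using that by (intro power2_less_imp_less[of _ e]) auto
    moreover have "y \<in> finite_combinations"
      unfolding finite_combinations_def y_def using F by blast
    ultimately show ?thesis by blast
  qed
  thus ?thesis by (auto simp: closure_approachable)
qed

lemma blinfun_eq_on_finite_combinations:
  fixes S S' :: "ell2 \<Rightarrow>\<^sub>L ell2"
  assumes "\<And>x. x \<in> finite_combinations \<Longrightarrow> blinfun_apply S x = blinfun_apply S' x"
  shows "S = S'"
proof (rule blinfun_eqI)
  fix x
  have "closed {x. blinfun_apply S x = blinfun_apply S' x}"
    by (intro closed_Collect_eq continuous_intros)
  hence "closure finite_combinations \<subseteq> {x. blinfun_apply S x = blinfun_apply S' x}"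
    using assms by (intro closure_minimal) auto
  thus "blinfun_apply S x = blinfun_apply S' x"
    by (auto simp: closure_finite_combinations)
qed

end

theory Submission
  imports Defs
begin

text \<open>A derivation that commutes with every \<open>\<rho>\<^sub>\<theta>\<close> preserves the degree in \<open>U\<close>.
  It maps diagonal operators to diagonal operators, and then the Leibniz rule for the projections onto
  the lines spanned by basis vectors makes it vanish on them. So \<open>d\<close> is determined by the weighted
  shifts \<open>d (U\<^sup>n)\<close>. With \<open>\<beta> n\<close> the weight of \<open>d (U\<^sup>n)\<close> at \<open>E\<^sub>0\<close>, the Leibniz rule for
  \<open>U\<^bsup>m+n\<^esup>\<close> says that \<open>d (U\<^sup>m)\<close> has weight \<open>\<beta> (m + n) - \<beta> n\<close> at \<open>E\<^sub>n\<close>,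
  which is the commutator formula. The increments of \<open>\<beta>\<close> are the first subdiagonal of \<open>d U\<close>.
  Elements of the quantum annulus are norm limits of elements of \<open>\<A>\<close>, whose subdiagonals are
  eventually constant, and convergence at infinity survives uniform limits.\<close>

section \<open>Eventually constant functions\<close>

text \<open>Decouples the two ends, which the definition ties to one threshold \<open>k0\<close>, so
  that each can be treated by filter reasoning.\<close>

lemma c00_pm_iff:
  "a \<in> c00_pm \<longleftrightarrow>
     (\<exists>c. \<forall>\<^sub>F k in at_top. a k = c) \<and> (\<exists>c. \<forall>\<^sub>F k in at_bot. a k = c)"
proof
  assume "a \<in> c00_pm"
  then show "(\<exists>c. \<forall>\<^sub>F k in at_top. a k = c) \<and> (\<exists>c. \<forall>\<^sub>F k in at_bot. a k = c)"
    unfolding c00_pm_def constant_on_def eventually_at_top_linorder eventually_at_bot_linorder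
    by (auto; blast)
next
  assume "(\<exists>c. \<forall>\<^sub>F k in at_top. a k = c) \<and> (\<exists>c. \<forall>\<^sub>F k in at_bot. a k = c)"
  then obtain c c' m n where "\<forall>k\<ge>m. a k = c" "\<forall>k\<le>n. a k = c'"
    unfolding eventually_at_top_linorder eventually_at_bot_linorder by blast
  \<comment> \<open>The maximum serves both ends: it is at least \<open>m\<close>, and its negative
    is at most \<open>n\<close>.\<close>
  then have "a constant_on {max m (- n)..} \<and> a constant_on {..- max m (- n)}"
    unfolding constant_on_def by auto
  then show "a \<in> c00_pm"
    unfolding c00_pm_def by blast
qed

lemma c00_pm_map:
  assumes "a \<in> c00_pm"
  shows "(\<lambda>k. f (a k)) \<in> c00_pm"
  using assms unfolding c00_pm_iff by (metis (mono_tags, lifting) eventually_mono)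

lemma c00_pm_map2:
  assumes "a \<in> c00_pm" "b \<in> c00_pm"
  shows "(\<lambda>k. f (a k) (b k)) \<in> c00_pm"
proof -
  have "\<exists>c. \<forall>\<^sub>F k in F. f (a k) (b k) = c"
    if a: "\<exists>c. \<forall>\<^sub>F k in F. a k = c" and b: "\<exists>c. \<forall>\<^sub>F k in F. b k = c" for F
  proof -
    obtain c c' where "\<forall>\<^sub>F k in F. a k = c" "\<forall>\<^sub>F k in F. b k = c'"
      using a b by blast
    then have "\<forall>\<^sub>F k in F. f (a k) (b k) = f c c'"
      by eventually_elim simp
    then show ?thesis by blast
  qed
  then show ?thesis
    using assms unfolding c00_pm_iff by blast
qed

lemma c00_pm_shift:
  assumes "a \<in> c00_pm"
  shows "(\<lambda>k. a (k + n)) \<in> c00_pm"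
proof -
  obtain c c' p q where "\<forall>k\<ge>p. a k = c" "\<forall>k\<le>q. a k = c'"
    using assms unfolding c00_pm_iff eventually_at_top_linorder eventually_at_bot_linorder by blast
  then have "\<forall>k\<ge>p - n. a (k + n) = c" "\<forall>k\<le>q - n. a (k + n) = c'"
    by auto
  then show ?thesis
    unfolding c00_pm_iff eventually_at_top_linorder eventually_at_bot_linorder by blast
qed

lemma c00_pm_const: "(\<lambda>_. c) \<in> c00_pm"
  unfolding c00_pm_iff by (auto intro!: exI[of _ c])

text \<open>Puts the projections onto the lines spanned by basis vectors into the domain of a
  derivation.\<close>

lemma c00_pm_single:
  fixes m :: int
  shows "(\<lambda>k. if k = m then c else 0) \<in> c00_pm"
proof -
  have "\<forall>\<^sub>F k::int in at_top. (if k = m then c else 0) = 0"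
    using eventually_gt_at_top[of m] by eventually_elim simp
  moreover have "\<forall>\<^sub>F k::int in at_bot. (if k = m then c else 0) = 0"
    using eventually_le_at_bot[of "m - 1"] by eventually_elim simp
  ultimately show ?thesis
    unfolding c00_pm_iff by blast
qed

lemma c00_pm_step: "(\<lambda>k. if k < 0 then c else c') \<in> c00_pm"
proof -
  have "\<forall>\<^sub>F k::int in at_top. (if k < 0 then c else c') = c'"
    using eventually_ge_at_top[of "0::int"] by eventually_elim simp
  moreover have "\<forall>\<^sub>F k::int in at_bot. (if k < 0 then c else c') = c"
    using eventually_le_at_bot[of "- 1::int"] by eventually_elim simp
  ultimately show ?thesis
    unfolding c00_pm_iff by blast
qed

lemmas coord_diag_c00 = coord_diag[OF bounded_c00_pm]

lemma blinfun_compose_id [simp]: "T o\<^sub>L id_blinfun = T" "id_blinfun o\<^sub>L T = T"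
  by (auto intro: blinfun_eqI)

lemmas blinfun_compose_add_left = bounded_bilinear.add_left[OF bounded_bilinear_blinfun_compose]
  and blinfun_compose_add_right = bounded_bilinear.add_right[OF bounded_bilinear_blinfun_compose]

section \<open>Matrix entries of bounded operators\<close>

text \<open>The row comes first, so \<open>Upow n\<close> is supported on \<open>i - j = n\<close>
  and \<open>i - j\<close> measures the degree in \<open>U\<close>.\<close>

definition mentry :: "(ell2 \<Rightarrow>\<^sub>L ell2) \<Rightarrow> int \<Rightarrow> int \<Rightarrow> complex" where
  "mentry T i j = coord (blinfun_apply T (basis_vec j)) i"

lemma coord_basis_vec: "coord (basis_vec k) j = (if j = k then 1 else 0)"
  by (simp add: basis_vec.rep_eq)

lemma basis_vec_finite: "basis_vec k \<in> finite_combinations"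
  by (simp add: finite_combinations_iff coord_basis_vec)

lemma norm_coord_le: "cmod (coord x k) \<le> norm x"
proof (rule power2_le_imp_le)
  have "sum (\<lambda>k. (cmod (coord x k))\<^sup>2) {k} \<le> infsum (\<lambda>k. (cmod (coord x k))\<^sup>2) UNIV"
    by (intro finite_sum_le_infsum coord_square_summable) auto
  then show "(cmod (coord x k))\<^sup>2 \<le> (norm x)\<^sup>2"
    by (simp add: norm_ell2_square)
qed simp

lemma norm_basis_vec: "norm (basis_vec k) = 1"
proof -
  have "(norm (basis_vec k))\<^sup>2 = infsum (\<lambda>j. (cmod (coord (basis_vec k) j))\<^sup>2) {k}"
    unfolding norm_ell2_square by (rule infsum_cong_neutral) (auto simp: coord_basis_vec)
  then have "(norm (basis_vec k))\<^sup>2 = 1\<^sup>2"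
    by (simp add: coord_basis_vec)
  then show ?thesis
    by (rule power2_eq_imp_eq) auto
qed

text \<open>The bound is independent of the position, so norm convergence of operators gives uniform
  convergence along each subdiagonal.\<close>

lemma norm_mentry_le: "cmod (mentry T i j) \<le> norm T"
  using order_trans[OF norm_coord_le norm_blinfun, of T "basis_vec j" i]
  by (simp add: mentry_def norm_basis_vec)

lemma mentry_diff: "mentry (S - T) i j = mentry S i j - mentry T i j"
  by (simp add: mentry_def blinfun.diff_left)

lemma mentry_opscale: "mentry (opscale c T) i j = c * mentry T i j"
  by (simp add: mentry_def opscale_apply)

lemma bounded_operatorsD:
  "T \<in> bounded_operators \<Longrightarrow> blinfun_apply T (cscale c x) = cscale c (blinfun_apply T x)"
  by (simp add: bounded_operators_def)

lemma coord_apply_finite: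
  assumes "T \<in> bounded_operators" "x \<in> finite_combinations"
  shows "coord (blinfun_apply T x) i = (\<Sum>j | coord x j \<noteq> 0. coord x j * mentry T i j)"
proof -
  let ?N = "{j. coord x j \<noteq> 0}"
  have fin: "finite ?N"
    using assms(2) by (simp add: finite_combinations_iff)
  have "x = (\<Sum>j\<in>?N. cscale (coord x j) (basis_vec j))"
    by (intro ell2_eqI)
      (simp add: coord_sum coord_basis_vec if_distrib[of "\<lambda>t. _ * t"] fin cong: if_cong)
  then have "coord (blinfun_apply T x) i =
      coord (blinfun_apply T (\<Sum>j\<in>?N. cscale (coord x j) (basis_vec j))) i"
    by simp
  then show ?thesis
    by (simp add: blinfun.sum_right coord_sum bounded_operatorsD[OF assms(1)] mentry_def)
qed

text \<open>Entries fix a complex linear operator on finite combinations, and these are dense. Mere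
  real linearity would leave the value at \<open>cscale \<i> (basis_vec j)\<close> free.\<close>

lemma mentry_eqI:
  assumes "S \<in> bounded_operators" "T \<in> bounded_operators" "\<And>i j. mentry S i j = mentry T i j"
  shows "S = T"
  using assms by (intro blinfun_eq_on_finite_combinations ell2_eqI) (simp add: coord_apply_finite)

lemma closed_bounded_operators: "closed bounded_operators"
proof -
  \<comment> \<open>With \<open>cscale c\<close> wrapped as a bounded operator, both sides of each
    equation are continuous in \<open>T\<close>.\<close>
  have eq: "bounded_operators =
      (\<Inter>c x. {T. blinfun_apply T (cscale c x) = (Blinfun (cscale c)) (blinfun_apply T x)})"
    by (auto simp: bounded_operators_def bounded_linear_Blinfun_apply[OF bounded_linear_cscale])
  show ?thesis
    unfolding eq by (intro closed_INT ballI closed_Collect_eq continuous_intros)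
qed

section \<open>Adjoints\<close>

lemma cinner_eq: "cinner x y = (\<Sum>\<^sub>\<infinity>k. cnj (coord x k) * coord y k)"
  by (simp add: cinner.rep_eq)

lemma cinner_add_left: "cinner (x + y) z = cinner x z + cinner y z"
  unfolding cinner_eq infsum_add[OF cinner_summable cinner_summable, symmetric]
  by (simp add: algebra_simps)

lemma cinner_add_right: "cinner z (x + y) = cinner z x + cinner z y"
  unfolding cinner_eq infsum_add[OF cinner_summable cinner_summable, symmetric]
  by (simp add: algebra_simps)

lemma cinner_diff_left: "cinner (x - y) z = cinner x z - cinner y z"
  using cinner_add_left[of "x - y" y z] by simp

lemma cinner_diff_right: "cinner z (x - y) = cinner z x - cinner z y"
  using cinner_add_right[of z "x - y" y] by simp

lemma is_adjoint_add:
  "is_adjoint S S' \<Longrightarrow> is_adjoint T T' \<Longrightarrow> is_adjoint (S + T) (S' + T')"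
  by (simp add: is_adjoint_def blinfun.add_left cinner_add_left cinner_add_right)

lemma is_adjoint_diff:
  "is_adjoint S S' \<Longrightarrow> is_adjoint T T' \<Longrightarrow> is_adjoint (S - T) (S' - T')"
  by (simp add: is_adjoint_def blinfun.diff_left cinner_diff_left cinner_diff_right)

text \<open>For \<open>y = T x\<close>, the square of the norm of \<open>y\<close> is the inner
  product of \<open>S y\<close> and \<open>x\<close>. Cauchy-Schwarz bounds it by
  \<open>norm S * norm y * norm x\<close>, and one factor \<open>norm y\<close> cancels.\<close>

lemma norm_adjoint_le:
  assumes "is_adjoint S T"
  shows "norm T \<le> norm S"
proof (rule norm_blinfun_bound)
  fix x
  let ?y = "blinfun_apply T x"
  have "norm ?y * norm ?y = inner (blinfun_apply S ?y) x"
    using assms power2_norm_eq_inner[of ?y]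
    by (simp add: is_adjoint_def inner_ell2_def power2_eq_square)
  also have "\<dots> \<le> norm (blinfun_apply S ?y) * norm x"
    by (rule norm_cauchy_schwarz)
  also have "\<dots> \<le> norm S * norm ?y * norm x"
    by (intro mult_right_mono norm_blinfun) auto
  finally have "norm ?y * norm ?y \<le> norm ?y * (norm S * norm x)"
    by (simp add: algebra_simps)
  then show "norm ?y \<le> norm S * norm x"
    by (cases "norm ?y = 0") auto
qed simp

text \<open>Moving the conjugate diagonal factor to the right of \<open>Upow (- n)\<close> restores
  the normal form and shifts its argument by \<open>n\<close>.\<close>

lemma is_adjoint_Upow_diag:
  assumes "a \<in> c00_pm"
  shows "is_adjoint (Upow n o\<^sub>L diag a) (Upow (- n) o\<^sub>L diag (\<lambda>k. cnj (a (k - n))))"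
  unfolding is_adjoint_def
proof (intro allI)
  fix x y
  have b: "(\<lambda>k. cnj (a (k - n))) \<in> c00_pm"
    using c00_pm_shift[OF c00_pm_map[OF assms, of cnj], of "- n"] by simp
  have "bij_betw (\<lambda>k. k + n) UNIV (UNIV :: int set)"
    by (rule bij_betwI[where g = "\<lambda>k. k - n"]) auto
  from infsum_reindex_bij_betw[OF this, of "\<lambda>k. cnj (a (k - n) * coord x (k - n)) * coord y k"]
  show "cinner (blinfun_apply (Upow n o\<^sub>L diag a) x) y =
      cinner x (blinfun_apply (Upow (- n) o\<^sub>L diag (\<lambda>k. cnj (a (k - n)))) y)"
    by (simp add: cinner_eq coord_diag_c00[OF assms] coord_diag_c00[OF b] algebra_simps)
qed

section \<open>The dense subalgebra\<close>

lemma Upow_diag_in_poly: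
  assumes "a \<in> c00_pm"
  shows "Upow n o\<^sub>L diag a \<in> poly_algebra"
  unfolding poly_algebra_def using assms
  by (auto intro!: exI[of _ "{n}"] exI[of _ "\<lambda>_. a"])

lemma diag_in_poly: "a \<in> c00_pm \<Longrightarrow> diag a \<in> poly_algebra"
  using Upow_diag_in_poly[of a 0] by (simp add: Upow_0)

lemma diag_one: "diag (\<lambda>_. 1) = id_blinfun"
  by (intro blinfun_eqI ell2_eqI) (simp add: coord_diag_c00[OF c00_pm_const])

lemma Upow_in_poly: "Upow n \<in> poly_algebra"
  using Upow_diag_in_poly[OF c00_pm_const[of 1], of n] by (simp add: diag_one)

lemma zero_in_poly: "0 \<in> poly_algebra"
  unfolding poly_algebra_def by (auto intro!: exI[of _ "{}"])

lemma diag_add: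
  assumes "a \<in> c00_pm" "b \<in> c00_pm"
  shows "diag (\<lambda>k. a k + b k) = diag a + diag b"
  by (intro blinfun_eqI ell2_eqI)
    (simp add: blinfun.add_left coord_diag_c00 c00_pm_map2 assms algebra_simps)

lemma add_in_poly:
  assumes "S \<in> poly_algebra" "T \<in> poly_algebra"
  shows "S + T \<in> poly_algebra"
proof -
  obtain M a where M: "finite M" "\<forall>n\<in>M. a n \<in> c00_pm" "S = (\<Sum>n\<in>M. Upow n o\<^sub>L diag (a n))"
    using assms(1) unfolding poly_algebra_def by blast
  obtain N b where N: "finite N" "\<forall>n\<in>N. b n \<in> c00_pm" "T = (\<Sum>n\<in>N. Upow n o\<^sub>L diag (b n))"
    using assms(2) unfolding poly_algebra_def by blast
  \<comment> \<open>Padding with zero coefficients gives both sums the index set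
    \<open>M \<union> N\<close>, so coefficients add degree by degree.\<close>
  define a' where "a' n = (if n \<in> M then a n else (\<lambda>_. 0))" for n
  define b' where "b' n = (if n \<in> N then b n else (\<lambda>_. 0))" for n
  have ab': "a' n \<in> c00_pm" "b' n \<in> c00_pm" for n
    using M(2) N(2) by (auto simp: a'_def b'_def c00_pm_const)
  have z: "diag (\<lambda>_. 0) = 0"
    by (intro blinfun_eqI ell2_eqI) (simp add: coord_diag_c00[OF c00_pm_const])
  have "S = (\<Sum>n\<in>M \<union> N. Upow n o\<^sub>L diag (a' n))" "T = (\<Sum>n\<in>M \<union> N. Upow n o\<^sub>L diag (b' n))"
    unfolding M(3) N(3) using M(1) N(1)
    by (auto intro!: sum.mono_neutral_cong_left simp: a'_def b'_def z)
  then have "S + T = (\<Sum>n\<in>M \<union> N. Upow n o\<^sub>L diag (\<lambda>k. a' n k + b' n k))"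
    by (simp add: diag_add ab' blinfun_compose_add_right sum.distrib)
  then show ?thesis
    unfolding poly_algebra_def using M(1) N(1) c00_pm_map2[OF ab', of "(+)"]
    by (intro CollectI exI[of _ "M \<union> N"] exI[of _ "\<lambda>n k. a' n k + b' n k"]) auto
qed

text \<open>Reduces additive statements to monomials. The \<open>add\<close> case supplies
  membership of both summands because \<open>d\<close> is additive only on
  \<open>poly_algebra\<close>.\<close>

lemma poly_induct [consumes 1, case_names zero monomial add]:
  assumes "T \<in> poly_algebra"
    and "P 0"
    and "\<And>n a. a \<in> c00_pm \<Longrightarrow> P (Upow n o\<^sub>L diag a)"
    and add: "\<And>S T. S \<in> poly_algebra \<Longrightarrow> T \<in> poly_algebra \<Longrightarrow> P S \<Longrightarrow> P T \<Longrightarrow> P (S + T)"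
  shows "P T"
proof -
  obtain N a where N: "finite N" "\<forall>n\<in>N. a n \<in> c00_pm" "T = (\<Sum>n\<in>N. Upow n o\<^sub>L diag (a n))"
    using assms(1) unfolding poly_algebra_def by blast
  from N(1,2) have "(\<Sum>n\<in>N. Upow n o\<^sub>L diag (a n)) \<in> poly_algebra \<and>
      P (\<Sum>n\<in>N. Upow n o\<^sub>L diag (a n))"
    by (induction N) (simp_all add: assms(2,3) add zero_in_poly add_in_poly Upow_diag_in_poly)
  then show ?thesis
    unfolding N(3) ..
qed

text \<open>Rests on the commutation rule \<open>a(K) U^n = U^n a(K + n)\<close>.\<close>

lemma Upow_diag_compose:
  assumes "a \<in> c00_pm" "b \<in> c00_pm"
  shows "(Upow m o\<^sub>L diag a) o\<^sub>L (Upow n o\<^sub>L diag b) =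
    Upow (m + n) o\<^sub>L diag (\<lambda>k. a (k + n) * b k)"
  using c00_pm_map2[OF c00_pm_shift[OF assms(1), of n] assms(2), of "(*)"]
  by (intro blinfun_eqI ell2_eqI) (simp add: coord_diag_c00 assms algebra_simps)

lemma compose_in_poly:
  assumes "S \<in> poly_algebra" "T \<in> poly_algebra"
  shows "S o\<^sub>L T \<in> poly_algebra"
  using assms(1)
proof (induction rule: poly_induct)
  case (monomial m a)
  show ?case
    using assms(2)
  proof (induction rule: poly_induct)
    case (monomial n b)
    then show ?case
      using c00_pm_map2[OF c00_pm_shift[OF \<open>a \<in> c00_pm\<close>, of n], of b "(*)"] \<open>a \<in> c00_pm\<close>
      by (simp add: Upow_diag_compose Upow_diag_in_poly)
  qed (auto simp: zero_in_poly add_in_poly blinfun_compose_add_right)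
qed (auto simp: zero_in_poly add_in_poly blinfun_compose_add_left)

text \<open>Turns closure under scalars into a case of closure under composition.\<close>

lemma opscale_eq_compose: "opscale c T = diag (\<lambda>_. c) o\<^sub>L T"
  by (intro blinfun_eqI ell2_eqI) (simp add: opscale_apply coord_diag_c00[OF c00_pm_const])

lemma poly_has_adjoint:
  assumes "T \<in> poly_algebra"
  shows "\<exists>S\<in>poly_algebra. is_adjoint T S"
  using assms
proof (induction rule: poly_induct)
  case zero
  then show ?case
    by (intro bexI[of _ 0] zero_in_poly) (simp add: is_adjoint_def cinner_eq)
next
  case (monomial n a)
  have "(\<lambda>k. cnj (a (k - n))) \<in> c00_pm"
    using c00_pm_shift[OF c00_pm_map[OF monomial, of cnj], of "- n"] by simp
  then show ?case
    using is_adjoint_Upow_diag[OF monomial] Upow_diag_in_poly by blast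
next
  case (add S T)
  then show ?case
    using add_in_poly is_adjoint_add by blast
qed

lemma poly_bounded_operators: "poly_algebra \<subseteq> bounded_operators"
proof
  fix T assume "T \<in> poly_algebra"
  then show "T \<in> bounded_operators"
  proof (induction rule: poly_induct)
    case zero
    show ?case by (auto simp: bounded_operators_def intro!: ell2_eqI)
  next
    case (monomial n a)
    then show ?case
      by (auto simp: bounded_operators_def coord_diag_c00 intro!: ell2_eqI)
  next
    case (add S T)
    then show ?case
      by (auto simp: bounded_operators_def blinfun.add_left algebra_simps intro!: ell2_eqI)
  qed
qed

text \<open>A monomial of degree \<open>m\<close> has entries only where \<open>i - j = m\<close>,
  so the subdiagonal of offset \<open>n\<close> reads off the coefficient of
  \<open>U^n\<close>.\<close>

lemma mentry_poly_subdiagonal: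
  assumes "T \<in> poly_algebra"
  shows "(\<lambda>k. mentry T (k + n) k) \<in> c00_pm"
  using assms
proof (induction rule: poly_induct)
  case zero
  then show ?case by (simp add: mentry_def c00_pm_const)
next
  case (monomial m a)
  have "mentry (Upow m o\<^sub>L diag a) (k + n) k = (if m = n then a k else 0)" for k
    by (auto simp: mentry_def coord_diag_c00[OF monomial] coord_basis_vec)
  then show ?case
    using monomial by (cases "m = n") (simp_all add: c00_pm_const)
next
  case (add S T)
  then show ?case
    using c00_pm_map2[OF add(3,4), of "(+)"] by (simp add: mentry_def blinfun.add_left)
qed

section \<open>The quantum annulus\<close>

lemma closure_poly_bounded_operators: "closure poly_algebra \<subseteq> bounded_operators"
  by (rule closure_minimal[OF poly_bounded_operators closed_bounded_operators])

lemma closure_poly_compose: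
  assumes "S \<in> closure poly_algebra" "T \<in> closure poly_algebra"
  shows "S o\<^sub>L T \<in> closure poly_algebra"
proof -
  obtain s t where "\<And>n. s n \<in> poly_algebra" "s \<longlonglongrightarrow> S" "\<And>n. t n \<in> poly_algebra" "t \<longlonglongrightarrow> T"
    using assms unfolding closure_sequential by blast
  moreover from this have "(\<lambda>n. s n o\<^sub>L t n) \<longlonglongrightarrow> (S o\<^sub>L T)"
    by (intro bounded_bilinear.tendsto[OF bounded_bilinear_blinfun_compose])
  ultimately show ?thesis
    unfolding closure_sequential using compose_in_poly by (intro exI[of _ "\<lambda>n. s n o\<^sub>L t n"]) auto
qed

lemma closure_poly_add:
  assumes "S \<in> closure poly_algebra" "T \<in> closure poly_algebra"
  shows "S + T \<in> closure poly_algebra"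
proof -
  obtain s t where "\<And>n. s n \<in> poly_algebra" "s \<longlonglongrightarrow> S" "\<And>n. t n \<in> poly_algebra" "t \<longlonglongrightarrow> T"
    using assms unfolding closure_sequential by blast
  moreover from this have "(\<lambda>n. s n + t n) \<longlonglongrightarrow> S + T"
    by (intro tendsto_add)
  ultimately show ?thesis
    unfolding closure_sequential using add_in_poly by (intro exI[of _ "\<lambda>n. s n + t n"]) auto
qed

text \<open>If \<open>P\<close> approximates \<open>T\<close> and has adjoint \<open>Q\<close>, then
  \<open>Q - S\<close> is the adjoint of \<open>P - T\<close> and no larger in norm.\<close>

lemma closure_poly_adjoint:
  assumes "T \<in> closure poly_algebra" "is_adjoint T S"
  shows "S \<in> closure poly_algebra"
  unfolding closure_approachable
proof (intro allI impI)
  fix e :: real assume "0 < e"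
  then obtain P where P: "P \<in> poly_algebra" "dist P T < e"
    using assms(1) unfolding closure_approachable by blast
  obtain Q where Q: "Q \<in> poly_algebra" "is_adjoint P Q"
    using poly_has_adjoint[OF P(1)] by blast
  have "dist Q S < e"
    using norm_adjoint_le[OF is_adjoint_diff[OF Q(2) assms(2)]] P(2) by (simp add: dist_norm)
  then show "\<exists>Q\<in>poly_algebra. dist Q S < e"
    using Q(1) by blast
qed

lemma unital_cstar_subalgebra_closure_poly: "unital_cstar_subalgebra (closure poly_algebra)"
proof -
  have "opscale c T \<in> closure poly_algebra" if "T \<in> closure poly_algebra" for c T
    unfolding opscale_eq_compose using that
    by (rule closure_poly_compose[OF closure_subset[THEN subsetD, OF diag_in_poly[OF c00_pm_const]]])
  moreover have "id_blinfun \<in> closure poly_algebra"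
    using Upow_in_poly[of 0] closure_subset by (auto simp: Upow_0)
  ultimately show ?thesis
    unfolding unital_cstar_subalgebra_def
    by (auto intro: closure_poly_compose closure_poly_add closure_poly_adjoint
      closure_poly_bounded_operators[THEN subsetD])
qed

text \<open>\<open>U_r r\<close> is a monomial of degree one, and the closure of
  \<open>poly_algebra\<close> is one of the algebras whose intersection is
  \<open>quantum_annulus r\<close>.\<close>

lemma quantum_annulus_subset_closure: "quantum_annulus r \<subseteq> closure poly_algebra"
proof -
  have "U_r r \<in> poly_algebra"
    unfolding U_r_def by (intro Upow_diag_in_poly c00_pm_step)
  then have "U_r r \<in> closure poly_algebra"
    using closure_subset by blast
  then show ?thesis
    unfolding quantum_annulus_def cstar_generated_def
    using unital_cstar_subalgebra_closure_poly by blast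
qed

text \<open>The constant \<open>c\<close> may vary with \<open>e\<close>, so no limit is known in
  advance. Eventually all values of \<open>f\<close> lie within \<open>e / 2\<close> of
  \<open>c\<close>, which makes the image filter Cauchy, and completeness supplies the
  limit.\<close>

lemma convergent_filter_uniform_approx:
  fixes f :: "'a \<Rightarrow> 'b :: complete_space"
  assumes "F \<noteq> bot"
    and approx: "\<And>e. 0 < e \<Longrightarrow> \<exists>g c. (\<forall>k. dist (g k) (f k) < e) \<and> (\<forall>\<^sub>F k in F. g k = c)"
  shows "\<exists>l. (f \<longlongrightarrow> l) F"
proof -
  have "cauchy_filter (filtermap f F)"
    unfolding cauchy_filter_metric_filtermap
  proof (intro allI impI)
    fix e :: real assume "0 < e"
    then obtain g c where g: "\<And>k. dist (g k) (f k) < e / 2" "\<forall>\<^sub>F k in F. g k = c"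
      using approx[of "e / 2"] by auto
    have "dist (f x) (f y) < e" if "g x = c" "g y = c" for x y
      using g(1)[of x] g(1)[of y] that by (metis dist_commute dist_triangle_half_l)
    then show "\<exists>P. eventually P F \<and> (\<forall>x y. P x \<and> P y \<longrightarrow> dist (f x) (f y) < e)"
      using g(2) by blast
  qed
  moreover have "filtermap f F \<noteq> bot"
    using assms(1) by (simp add: filtermap_bot_iff)
  ultimately obtain l where "filtermap f F \<le> nhds l"
    using complete_uniform[of "UNIV :: 'b set"] complete_UNIV by auto
  then show ?thesis
    unfolding filterlim_def by blast
qed

lemma mentry_closure_subdiagonal:
  assumes "T \<in> closure poly_algebra"
  shows "(\<lambda>k. mentry T (k + n) k) \<in> c_Z"
proof -
  have approx: "\<exists>g\<in>c00_pm. \<forall>k. dist (g k) (mentry T (k + n) k) < e" if "0 < e" for e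
  proof -
    obtain P where P: "P \<in> poly_algebra" "dist P T < e"
      using assms \<open>0 < e\<close> unfolding closure_approachable by blast
    have "dist (mentry P (k + n) k) (mentry T (k + n) k) < e" for k
      using norm_mentry_le[of "P - T" "k + n" k] P(2) by (simp add: dist_norm mentry_diff)
    then show ?thesis
      by (intro bexI[OF _ mentry_poly_subdiagonal[OF P(1), of n]] allI)
  qed
  have "\<exists>l. ((\<lambda>k. mentry T (k + n) k) \<longlongrightarrow> l) at_top"
    by (rule convergent_filter_uniform_approx) (use approx in \<open>force simp: c00_pm_iff\<close>)+
  moreover have "\<exists>l. ((\<lambda>k. mentry T (k + n) k) \<longlongrightarrow> l) at_bot"
    by (rule convergent_filter_uniform_approx) (use approx in \<open>force simp: c00_pm_iff\<close>)+
  ultimately show ?thesis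
    by (simp add: c_Z_def)
qed

lemma c_Z_shift:
  assumes "a \<in> c_Z"
  shows "(\<lambda>k. a (k + n)) \<in> c_Z"
proof -
  have "filterlim (\<lambda>k. k + n) at_top (at_top :: int filter)"
    unfolding filterlim_at_top eventually_at_top_linorder
    by (metis diff_le_eq)
  moreover have "filterlim (\<lambda>k. k + n) at_bot (at_bot :: int filter)"
    unfolding filterlim_at_bot eventually_at_bot_linorder
    by (metis le_diff_eq)
  ultimately show ?thesis
    using assms unfolding c_Z_def by (auto dest: filterlim_compose[rotated])
qed

section \<open>Invariant derivations\<close>

text \<open>Conjugation by the phases sees only the degree \<open>i - j\<close>. Complex linearity
  lets the phase of column \<open>j\<close> pass through \<open>T\<close>.\<close>

lemma mentry_rho:
  assumes "T \<in> bounded_operators"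
  shows "mentry (rho \<theta> T) i j = exp (\<i> * of_real \<theta> * of_int (i - j)) * mentry T i j"
proof -
  have b1: "bounded (range (\<lambda>k::int. exp (\<i> * of_real \<theta> * of_int k)))"
    and b2: "bounded (range (\<lambda>k::int. exp (- \<i> * of_real \<theta> * of_int k)))"
    unfolding bounded_iff by (auto intro!: exI[of _ 1])
  have "blinfun_apply (diag (\<lambda>k. exp (- \<i> * of_real \<theta> * of_int k))) (basis_vec j) =
      cscale (exp (- \<i> * of_real \<theta> * of_int j)) (basis_vec j)"
    by (intro ell2_eqI) (simp only: coord_diag[OF b2], simp add: coord_basis_vec)
  then show ?thesis
    unfolding mentry_def rho_def
    by (simp only: blinfun_apply_blinfun_compose coord_diag[OF b1] bounded_operatorsD[OF assms]
        coord_cscale)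
      (simp add: right_diff_distrib exp_diff exp_minus field_simps)
qed

text \<open>The angle \<open>pi / \<bar>m - n\<bar>\<close> makes the quotient of the two phases
  equal to \<open>-1\<close>.\<close>

lemma rotation_separates:
  fixes m n :: int
  assumes "m \<noteq> n"
  obtains \<theta> where "\<theta> \<in> {0..<2 * pi}"
    "exp (\<i> * of_real \<theta> * of_int m) \<noteq> exp (\<i> * of_real \<theta> * of_int n)"
proof
  define \<theta> where "\<theta> = pi / real_of_int \<bar>m - n\<bar>"
  have "1 \<le> real_of_int \<bar>m - n\<bar>"
    using assms by linarith
  then show "\<theta> \<in> {0..<2 * pi}"
    using pi_gt_zero by (auto simp: \<theta>_def field_simps intro: less_le_trans)
  have "\<theta> * real_of_int (m - n) = pi \<or> \<theta> * real_of_int (m - n) = - pi"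
    using assms by (auto simp: \<theta>_def abs_if field_simps)
  then have "cis (\<theta> * real_of_int (m - n)) = -1"
    by (metis cis_pi cis_cnj complex_cnj_minus complex_cnj_one)
  then have "exp (\<i> * of_real \<theta> * of_int m) / exp (\<i> * of_real \<theta> * of_int n) = -1"
    by (simp add: cis_conv_exp exp_diff[symmetric] algebra_simps)
  then show "exp (\<i> * of_real \<theta> * of_int m) \<noteq> exp (\<i> * of_real \<theta> * of_int n)"
    by auto
qed

theorem proposition3p1:
  fixes r :: real and d :: "(ell2 \<Rightarrow>\<^sub>L ell2) \<Rightarrow> (ell2 \<Rightarrow>\<^sub>L ell2)"
  assumes "0 < r" "r < 1"
    and "is_derivation poly_algebra (quantum_annulus r) d"
    and "rho_invariant d"
  shows "\<exists>\<beta>\<in>c_inc. (\<forall>T\<in>poly_algebra. extends_commutator (d T) \<beta> T) \<and>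
           (\<forall>\<beta>'\<in>c_inc. (\<forall>T\<in>poly_algebra. extends_commutator (d T) \<beta>' T) \<longrightarrow>
              (\<exists>c. \<forall>k. \<beta>' k = \<beta> k + c)) \<and>
           (d ` poly_algebra \<subseteq> poly_algebra \<longrightarrow> eventually_linear \<beta>)"
proof -
  have d_closure: "d T \<in> closure poly_algebra" if "T \<in> poly_algebra" for T
    using assms(3) that quantum_annulus_subset_closure unfolding is_derivation_def by blast
  then have d_bounded: "d T \<in> bounded_operators" if "T \<in> poly_algebra" for T
    using that closure_poly_bounded_operators by blast
  have d_add: "d (S + T) = d S + d T" and d_mult: "d (S o\<^sub>L T) = (S o\<^sub>L d T) + (d S o\<^sub>L T)"
    and d_scale: "d (opscale c T) = opscale c (d T)"
    if "S \<in> poly_algebra" "T \<in> poly_algebra" for S T c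
    using assms(3) that unfolding is_derivation_def by blast+

  \<comment> \<open>Invariance and homogeneity multiply every entry of \<open>d ?T\<close> by the
    phase of degree \<open>n\<close>, while \<open>mentry_rho\<close> gives the phase of degree
    \<open>i - j\<close>. An angle separating the two forces the entry to vanish.\<close>
  have degree: "mentry (d (Upow n o\<^sub>L diag a)) i j = 0" if a: "a \<in> c00_pm" and "i - j \<noteq> n" for n a i j
  proof -
    let ?T = "Upow n o\<^sub>L diag a"
    have T: "?T \<in> poly_algebra"
      by (rule Upow_diag_in_poly[OF a])
    obtain \<theta> where \<theta>: "\<theta> \<in> {0..<2 * pi}"
      "exp (\<i> * of_real \<theta> * of_int (i - j)) \<noteq> exp (\<i> * of_real \<theta> * of_int n)"
      using rotation_separates[OF \<open>i - j \<noteq> n\<close>] by blast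
    have "rho \<theta> (d ?T) = opscale (exp (\<i> * of_real \<theta> * of_int n)) (d ?T)"
      using assms(4) \<theta>(1) T by (simp add: rho_invariant_def rho_Upow_diag[OF a] d_scale[OF T T])
    then have "exp (\<i> * of_real \<theta> * of_int (i - j)) * mentry (d ?T) i j =
        exp (\<i> * of_real \<theta> * of_int n) * mentry (d ?T) i j"
      using mentry_rho[OF d_bounded[OF T], of \<theta> i j] by (simp only: mentry_opscale)
    then show ?thesis
      using \<theta>(2) by simp
  qed

  have d_diag: "d (diag a) = 0" if a: "a \<in> c00_pm" for a
  proof (rule mentry_eqI)
    fix i j
    show "mentry (d (diag a)) i j = mentry 0 i j"
    proof (cases "i = j")
      case True
      define p where "p k = (if k = j then 1 else 0 :: complex)" for k
      have p: "p \<in> c00_pm"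
        using c00_pm_single[of j 1] by (simp add: p_def[abs_def])
      have apply_p: "blinfun_apply (diag p) (basis_vec j) = basis_vec j"
        by (intro ell2_eqI) (simp add: coord_diag_c00[OF p] coord_basis_vec p_def)
      have "diag p o\<^sub>L diag p = diag p"
        by (intro blinfun_eqI ell2_eqI) (simp add: coord_diag_c00[OF p] p_def)
      \<comment> \<open>Leibniz for the idempotent \<open>diag p\<close> gives
        \<open>x = 2 * x\<close> for its entry at \<open>(j, j)\<close>.\<close>
      then have "mentry (d (diag p)) j j = mentry ((diag p o\<^sub>L d (diag p)) + (d (diag p) o\<^sub>L diag p)) j j"
        using d_mult[OF diag_in_poly[OF p] diag_in_poly[OF p]] by simp
      also have "\<dots> = 2 * mentry (d (diag p)) j j"
        by (simp add: mentry_def blinfun.add_left coord_diag_c00[OF p] apply_p)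
          (simp add: p_def)
      finally have dp: "mentry (d (diag p)) j j = 0"
        by simp
      have "diag a o\<^sub>L diag p = opscale (a j) (diag p)"
        by (intro blinfun_eqI ell2_eqI)
          (simp add: opscale_apply coord_diag_c00[OF p] coord_diag_c00[OF a] p_def)
      \<comment> \<open>Both \<open>a j\<close> terms contain the entry of \<open>d (diag p)\<close>
        just shown to be zero; what remains is the entry of \<open>d (diag a)\<close>.\<close>
      then have "mentry (opscale (a j) (d (diag p))) j j =
          mentry ((diag a o\<^sub>L d (diag p)) + (d (diag a) o\<^sub>L diag p)) j j"
        using d_mult[OF diag_in_poly[OF a] diag_in_poly[OF p]]
          d_scale[OF diag_in_poly[OF p] diag_in_poly[OF p]] by simp
      then have "mentry (d (diag a)) j j = 0"
        using dp by (simp add: mentry_opscale)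
          (simp add: mentry_def blinfun.add_left coord_diag_c00[OF a] apply_p)
      then show ?thesis
        using True by (simp add: mentry_def)
    next
      case False
      then show ?thesis
        using degree[OF a, of i j 0] by (simp add: Upow_0 mentry_def)
    qed
  qed (use d_bounded[OF diag_in_poly[OF a]] poly_bounded_operators zero_in_poly in auto)

  \<comment> \<open>A commutator with \<open>\<gamma>\<close> has the entry
    \<open>\<gamma> n - \<gamma> 0\<close> here, so this choice is the candidate normalised to
    vanish at 0.\<close>
  define \<beta> where "\<beta> n = mentry (d (Upow n)) n 0" for n
  have weight: "mentry (d (Upow m)) (n + m) n = \<beta> (n + m) - \<beta> n" for m n
  proof -
    \<comment> \<open>In the first summand \<open>Upow m\<close> moves row \<open>n\<close> to row
      \<open>m + n\<close>, leaving \<open>\<beta> n\<close>. In the second, \<open>Upow n\<close>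
      sends the basis vector at 0 to the one at \<open>n\<close>.\<close>
    have "\<beta> (m + n) = mentry ((Upow m o\<^sub>L d (Upow n)) + (d (Upow m) o\<^sub>L Upow n)) (m + n) 0"
      unfolding \<beta>_def Upow_add d_mult[OF Upow_in_poly Upow_in_poly] ..
    then show ?thesis
      by (simp add: \<beta>_def mentry_def blinfun.add_left Upow_basis_vec add.commute)
  qed
  have d_Upow: "coord (blinfun_apply (d (Upow n)) x) k = (\<beta> k - \<beta> (k - n)) * coord x (k - n)"
    if x: "x \<in> finite_combinations" for n x k
  proof -
    have entry: "mentry (d (Upow n)) k j = (if j = k - n then \<beta> k - \<beta> (k - n) else 0)" for j
      using degree[OF c00_pm_const[of 1], of k j n] weight[of n "k - n"] by (auto simp: diag_one)
    have fin: "finite {j. coord x j \<noteq> 0}"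
      using x by (simp add: finite_combinations_iff)
    show ?thesis
      unfolding coord_apply_finite[OF d_bounded[OF Upow_in_poly] x] entry
      by (simp add: if_distrib[of "\<lambda>t. _ * t"] fin cong: if_cong)
  qed

  have commutator: "extends_commutator (d T) \<beta> T" if "T \<in> poly_algebra" for T
    using that
  proof (induction rule: poly_induct)
    case zero
    have "d 0 = 0"
      using d_add[OF zero_in_poly zero_in_poly] by simp
    then show ?case
      by (auto simp: extends_commutator_def coord_diag_fun_finite finite_combinations_iff
        intro!: ell2_eqI)
  next
    case (monomial n a)
    \<comment> \<open>The other Leibniz term contains \<open>d (diag a)\<close>, which is
      zero.\<close>
    have d_eq: "d (Upow n o\<^sub>L diag a) = d (Upow n) o\<^sub>L diag a"
      unfolding d_mult[OF Upow_in_poly diag_in_poly[OF monomial]] d_diag[OF monomial] by simp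
    show ?case
      unfolding extends_commutator_def
    proof
      fix x assume x: "x \<in> finite_combinations"
      show "blinfun_apply (d (Upow n o\<^sub>L diag a)) x =
          diag_fun \<beta> (blinfun_apply (Upow n o\<^sub>L diag a) x) - blinfun_apply (Upow n o\<^sub>L diag a) (diag_fun \<beta> x)"
        unfolding d_eq
        using poly_algebra_finite_combinations[OF diag_in_poly[OF monomial] x]
          poly_algebra_finite_combinations[OF Upow_diag_in_poly[OF monomial] x, of n]
        by (intro ell2_eqI)
          (simp add: d_Upow coord_diag_fun_finite x coord_diag_c00[OF monomial] algebra_simps)
    qed
  next
    case (add S T)
    show ?case
      unfolding extends_commutator_def
    proof
      fix x assume x: "x \<in> finite_combinations"
      \<comment> \<open>That \<open>R\<close> preserves finite combinations keeps
        \<open>blinfun_apply R x\<close> in the domain of the diagonal operator, away from the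
        default value 0 of \<open>diag_fun\<close>.\<close>
      have *: "coord (blinfun_apply (d R) x) k =
          \<beta> k * coord (blinfun_apply R x) k - coord (blinfun_apply R (diag_fun \<beta> x)) k"
        if "extends_commutator (d R) \<beta> R" "R \<in> poly_algebra" for R k
        using that x poly_algebra_finite_combinations[OF that(2) x]
        by (simp add: extends_commutator_def coord_diag_fun_finite)
      show "blinfun_apply (d (S + T)) x =
          diag_fun \<beta> (blinfun_apply (S + T) x) - blinfun_apply (S + T) (diag_fun \<beta> x)"
        using *[OF add(3,1)] *[OF add(4,2)]
          poly_algebra_finite_combinations[OF add_in_poly[OF add(1,2)] x]
        unfolding d_add[OF add(1,2)]
        by (intro ell2_eqI) (simp add: blinfun.add_left coord_diag_fun_finite algebra_simps)
    qed
  qed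

  have unique: "\<exists>c. \<forall>k. \<beta>' k = \<beta> k + c" if "\<forall>T\<in>poly_algebra. extends_commutator (d T) \<beta>' T" for \<beta>'
  proof -
    \<comment> \<open>Evaluating the commutator with \<open>Upow k\<close> at the basis vector at 0
      recovers any admissible function up to its value at 0.\<close>
    have "mentry (d (Upow k)) k 0 = \<gamma> k - \<gamma> 0"
      if "\<forall>T\<in>poly_algebra. extends_commutator (d T) \<gamma> T" for \<gamma> k
      using that[rule_format, OF Upow_in_poly[of k], unfolded extends_commutator_def, rule_format,
          OF basis_vec_finite[of 0]]
      by (simp add: mentry_def Upow_basis_vec coord_diag_fun_finite basis_vec_finite coord_basis_vec)
    from this[OF that] this[of \<beta>] commutator have "\<beta>' k - \<beta>' 0 = \<beta> k - \<beta> 0" for k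
      by metis
    then have "\<beta>' k = \<beta> k + (\<beta>' 0 - \<beta> 0)" for k
      by (metis add_diff_cancel_left' add_diff_eq diff_add_cancel)
    then show ?thesis by blast
  qed

  \<comment> \<open>The increment at \<open>k\<close> is the weight of \<open>d (Upow 1)\<close> in
    column \<open>k - 1\<close>. Writing the column as \<open>k + - 1\<close> exposes a subdiagonal
    shifted by \<open>- 1\<close>, ready for the shift lemmas.\<close>
  have increment: "(\<lambda>k. \<beta> k - \<beta> (k - 1)) = (\<lambda>k. mentry (d (Upow 1)) ((k + - 1) + 1) (k + - 1))"
    by (rule ext, subst weight) simp
  have "\<beta> \<in> c_inc"
    unfolding c_inc_def mem_Collect_eq increment
    by (rule c_Z_shift[OF mentry_closure_subdiagonal[OF d_closure[OF Upow_in_poly]]])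
  moreover have "eventually_linear \<beta>" if "d ` poly_algebra \<subseteq> poly_algebra"
    unfolding eventually_linear_def increment
    by (rule c00_pm_shift[OF mentry_poly_subdiagonal]) (use that Upow_in_poly in auto)
  ultimately show ?thesis
    using commutator unique by blast
qed

end
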